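(* Let $k$ and $n$ be two positive integers such that $1 \leq k < 10n-1$ and suppose that $\frac{k}{10n-1} = 0.\overline{a_1 \dots a_l}$, where $l$ is the length of the period of the decimal expansion $0.\overline{a_1 \dots a_l}$. For any $i \in \{1, \dots, l\}$ let $\tilde{q}_i, \tilde{r}_i$ be the nonnegative integers such that $$10^i \cdot k = \tilde{q}_i (10n-1) + \tilde{r}_i, \qquad 0 \leq \tilde{r}_i < 10n-1.$$ Then, for any $i \in \{1, \dots, l\}$: (1) $u(\tilde{q}_i) = a_i$; (2) $u(\tilde{q}_i) = u(\tilde{r}_i)$.
   Context: $\mathbf{N}$ denotes the set of nonnegative integers. The map $u : \mathbf{N} \to \{0, \dots, 9\}$ takes any nonnegative integer, represented in base $10$, to its rightmost digit (for example $u(127) = 7$); that is, $u(d)$ is the remainder of the Euclidean division of $d$ by $10$. The notation $0.\overline{a_1 \dots a_l}$ denotes the purely periodic decimal expansion with digits $a_1, \dots, a_l \in \{0, \dots, 9\}$ repeated indefinitely in this order. *)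

theory Defs
  imports Complex_Main
begin

definition last_digit :: "nat \<Rightarrow> nat" where
  "last_digit d = d mod 10"

text \<open>The real number written 0, decimal point, then the block of digits a 1, ..., a l repeated
  indefinitely. Blocks are indexed from 1, the series from 0, so its \<open>j\<close>-th term carries the
  digit in decimal place \<open>j + 1\<close>. Only \<open>l \<ge> 1\<close> is meaningful, and only the values of \<open>a\<close>
  on \<open>{1..l}\<close> matter then.\<close>

definition periodic_decimal :: "nat \<Rightarrow> (nat \<Rightarrow> nat) \<Rightarrow> real" where
  "periodic_decimal l a = (\<Sum>j. real (a (j mod l + 1)) / 10 ^ (j + 1))"

end

theory Submission
  imports Defs
begin

text \<open>
  Let \<open>x = k / (10 n - 1)\<close> and let \<open>T i\<close> be the value of the expansion of \<open>x\<close> after its first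
  \<open>i\<close> digits are dropped. Then \<open>10 * T i\<close> is the next digit plus \<open>T (i + 1)\<close>, and \<open>T i \<le> 1\<close>.
  If \<open>T i = 1\<close> for some \<open>i\<close>, then the same holds from \<open>i\<close> on, so \<open>x = T 0 = 1\<close> by periodicity,
  which is impossible. Hence \<open>T i < 1\<close> and the quotient is the floor of \<open>10 ^ i * x\<close>, whose last
  digit is the \<open>i\<close>-th digit of \<open>x\<close>. The second claim is the division identity modulo 10,
  because \<open>10 n - 1\<close> is congruent to \<open>-1\<close>.
\<close>

definition decimal_tail :: "(nat \<Rightarrow> nat) \<Rightarrow> nat \<Rightarrow> real" where
  "decimal_tail d i = (\<Sum>j. real (d (j + i)) / 10 ^ (j + 1))"

text \<open>The expansion 0.999... dominates every digit series termwise; this gives both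
  summability and the bound 1 on the tails.\<close>

lemma nines_sums_1: "(\<lambda>j. 9 / 10 ^ (j + 1)) sums (1::real)"
proof -
  have "(\<lambda>j. 9 / 10 * (1 / 10) ^ j) sums (9 / 10 * (1 / (1 - 1 / 10 :: real)))"
    by (intro sums_mult geometric_sums) simp
  then show ?thesis
    by (simp add: power_divide)
qed

context
  fixes d :: "nat \<Rightarrow> nat"
  assumes digit_le: "\<And>j. d j \<le> 9"
begin

lemma digit_term_le: "real (d (j + i)) / 10 ^ (j + 1) \<le> 9 / 10 ^ (j + 1)"
  using digit_le[of "j + i"] by (intro divide_right_mono) auto

lemma summable_decimal_tail: "summable (\<lambda>j. real (d (j + i)) / 10 ^ (j + 1))"
  by (rule summable_comparison_test'[OF sums_summable[OF nines_sums_1], where N = 0])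
    (use digit_term_le in auto)

lemma decimal_tail_nonneg: "0 \<le> decimal_tail d i"
  unfolding decimal_tail_def by (intro suminf_nonneg summable_decimal_tail) simp

lemma decimal_tail_le_1: "decimal_tail d i \<le> 1"
proof -
  have "decimal_tail d i \<le> (\<Sum>j. 9 / 10 ^ (j + 1))"
    unfolding decimal_tail_def
    by (intro suminf_le digit_term_le summable_decimal_tail sums_summable[OF nines_sums_1])
  then show ?thesis
    using sums_unique[OF nines_sums_1] by simp
qed

lemma decimal_tail_Suc: "10 * decimal_tail d i = real (d i) + decimal_tail d (Suc i)"
proof -
  have "10 * decimal_tail d i = (\<Sum>j. 10 * (real (d (j + i)) / 10 ^ (j + 1)))"
    unfolding decimal_tail_def by (rule suminf_mult[OF summable_decimal_tail, symmetric])
  also have "\<dots> = (\<Sum>j. 10 * (real (d (Suc j + i)) / 10 ^ (Suc j + 1))) + real (d i)"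
    using suminf_split_head[OF summable_mult[OF summable_decimal_tail[of i], of 10]] by simp
  finally show ?thesis
    by (simp add: decimal_tail_def)
qed

text \<open>In \<open>10 = d j + decimal_tail d (Suc j)\<close> the summands are at most 9 and 1, so
  both attain their bounds.\<close>

lemma decimal_tail_eq_1_mono:
  assumes "decimal_tail d i = 1" and "i \<le> j"
  shows "decimal_tail d j = 1"
  using assms(2)
proof (induction j rule: dec_induct)
  case base
  show ?case by (fact assms(1))
next
  case (step j)
  then have "10 = real (d j) + decimal_tail d (Suc j)"
    using decimal_tail_Suc[of j] by simp
  moreover have "real (d j) \<le> 9"
    using digit_le[of j] by simp
  ultimately show ?case
    using decimal_tail_le_1[of "Suc j"] by linarith
qed

lemma decimal_tail_less_1:
  assumes periodic: "\<And>j. d (j + l) = d j" and "1 \<le> l" and "decimal_tail d 0 < 1"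
  shows "decimal_tail d i < 1"
proof (rule ccontr)
  assume "\<not> decimal_tail d i < 1"
  then have "decimal_tail d i = 1"
    using decimal_tail_le_1[of i] by simp
  \<comment> \<open>The multiple \<open>i * l\<close> of the period lies at or beyond
    \<open>i\<close>, and the tail there is \<open>decimal_tail d 0\<close> again.\<close>
  moreover have "i \<le> i * l"
    using \<open>1 \<le> l\<close> by simp
  ultimately have "decimal_tail d (i * l) = 1"
    by (rule decimal_tail_eq_1_mono)
  moreover have "d (j + i * l) = d j" for j
    using periodic[of "j + _ * l"] by (induction i) (simp_all add: ac_simps)
  ultimately show False
    using assms(3) by (simp add: decimal_tail_def)
qed

text \<open>\<open>N\<close> is the number written by the first \<open>i\<close> digits; appending
  \<open>d i\<close> turns it into \<open>10 * N + d i\<close>.\<close>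

lemma power_mult_decimal_tail:
  "\<exists>N::nat. 10 ^ i * decimal_tail d 0 = real N + decimal_tail d i"
proof (induction i)
  case 0
  show ?case by (intro exI[of _ 0]) simp
next
  case (Suc i)
  then obtain N :: nat where "10 ^ i * decimal_tail d 0 = real N + decimal_tail d i"
    by blast
  then have "10 ^ Suc i * decimal_tail d 0 = real (10 * N + d i) + decimal_tail d (Suc i)"
    using decimal_tail_Suc[of i] by simp
  then show ?case by blast
qed

text \<open>Strictness matters: a tail equal to 1 would carry into the integer part and change its
  last digit.\<close>

lemma floor_power_mult_mod_10:
  assumes "decimal_tail d (Suc i) < 1"
  shows "\<lfloor>10 ^ Suc i * decimal_tail d 0\<rfloor> mod 10 = int (d i)"
proof -
  obtain N :: nat where "10 ^ i * decimal_tail d 0 = real N + decimal_tail d i"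
    using power_mult_decimal_tail by blast
  then have "10 ^ Suc i * decimal_tail d 0 = real (10 * N + d i) + decimal_tail d (Suc i)"
    using decimal_tail_Suc[of i] by simp
  then have "\<lfloor>10 ^ Suc i * decimal_tail d 0\<rfloor> = int (10 * N + d i)"
    using assms decimal_tail_nonneg[of "Suc i"] by (intro floor_unique) simp_all
  then show ?thesis
    using digit_le[of i] by simp
qed

end

lemma quotient_remainder_mod_10:
  fixes k n q r i :: nat
  assumes "1 \<le> n" and "1 \<le> i" and "10 ^ i * k = q * (10 * n - 1) + r"
  shows "q mod 10 = r mod 10"
proof -
  obtain i' where i: "i = Suc i'"
    using \<open>1 \<le> i\<close> by (cases i) auto
  \<comment> \<open>Adding \<open>q\<close> to the division identity clears the truncated
    subtraction; \<open>10 ^ i * k\<close> is a multiple of 10 as \<open>i\<close> is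
    positive.\<close>
  have "q * (10 * n - 1) + q = q * (10 * n)"
    using \<open>1 \<le> n\<close> by (simp add: diff_mult_distrib2)
  then have "q + 10 * (10 ^ i' * k) = r + 10 * (q * n)"
    using assms(3) i by simp
  then have "(q + 10 * (10 ^ i' * k)) mod 10 = (r + 10 * (q * n)) mod 10"
    by simp
  then show ?thesis
    by (simp only: mod_mult_self2)
qed

theorem theorem2p5:
  fixes k n l :: nat and a q r :: "nat \<Rightarrow> nat"
  assumes "1 \<le> n" and "1 \<le> k" and "k < 10 * n - 1"
    and "1 \<le> l"
    and "\<forall>i\<in>{1..l}. a i \<in> {0..9}"
    and "real k / real (10 * n - 1) = periodic_decimal l a"
    and "\<forall>i\<in>{1..l}. 10 ^ i * k = q i * (10 * n - 1) + r i \<and> 0 \<le> r i \<and> r i < 10 * n - 1"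
  shows "\<forall>i\<in>{1..l}. last_digit (q i) = a i \<and> last_digit (q i) = last_digit (r i)"
proof
  fix i assume i: "i \<in> {1..l}"
  define m where "m = 10 * n - 1"
  define d where "d j = a (j mod l + 1)" for j
  have digit_le: "d j \<le> 9" for j
  proof -
    have "j mod l + 1 \<in> {1..l}"
      using assms(4) by (simp add: Suc_le_eq)
    then show ?thesis
      using assms(5) by (auto simp: d_def)
  qed
  have x: "decimal_tail d 0 = real k / real m"
    using assms(6) by (simp add: decimal_tail_def periodic_decimal_def d_def m_def)
  \<comment> \<open>\<open>d\<close> counts from 0 and \<open>a\<close> from 1, so
    \<open>a i\<close> is \<open>d i'\<close>; here \<open>i' < l\<close> gives
    \<open>i' mod l = i'\<close>.\<close>
  obtain i' where i': "i = Suc i'" "i' < l"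
    using i by (cases i) auto
  have "decimal_tail d i < 1"
  proof (rule decimal_tail_less_1[OF digit_le])
    show "decimal_tail d 0 < 1"
      using x assms(3) by (simp add: m_def)
    show "1 \<le> l" by (fact assms(4))
  qed (simp add: d_def)
  then have "\<lfloor>10 ^ i * decimal_tail d 0\<rfloor> mod 10 = int (a i)"
    using floor_power_mult_mod_10[of d i'] digit_le i' by (simp add: d_def)
  moreover have "\<lfloor>10 ^ i * decimal_tail d 0\<rfloor> = int (q i)"
  proof -
    have div: "10 ^ i * k = q i * m + r i" and "r i < m"
      using assms(7) i by (auto simp: m_def)
    have "10 ^ i * decimal_tail d 0 = real (10 ^ i * k) / real m"
      by (simp add: x)
    then have "\<lfloor>10 ^ i * decimal_tail d 0\<rfloor> = int (10 ^ i * k div m)"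
      by (simp only: floor_divide_of_nat_eq)
    then show ?thesis
      using div \<open>r i < m\<close> by simp
  qed
  ultimately have "last_digit (q i) = a i"
    by (metis last_digit_def of_nat_eq_iff of_nat_mod of_nat_numeral)
  moreover have "last_digit (q i) = last_digit (r i)"
    using quotient_remainder_mod_10[OF assms(1), of i k "q i" "r i"] assms(7) i
    by (simp add: last_digit_def)
  ultimately show "last_digit (q i) = a i \<and> last_digit (q i) = last_digit (r i)" ..
qed

end
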